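(* Let $G$ be a finite group. Then the power graph $\mathcal{P}(G)$ is $K_{1,4}$-free if and only if $G$ is isomorphic to one of the groups $Q_8$, $\mathbb{Z}_2\times\mathbb{Z}_2$, $\mathbb{Z}_{p^k}$, $\mathbb{Z}_{pqr}$ or $\mathbb{Z}_{p^m q^n}$, for some distinct primes $p,q,r$ and some non-negative integers $k,m,n$, where $\{m,n\}\cap\{0,1,2\}\neq\emptyset$.
   Context: The power graph $\mathcal{P}(G)$ of a finite group $G$ is the simple graph with vertex set $G$ in which two distinct elements $x,y$ are adjacent if and only if $x\in\langle y\rangle$ or $y\in\langle x\rangle$. A graph is $\Gamma$-free if it has no induced subgraph isomorphic to $\Gamma$. $Q_8$ is the quaternion group of order $8$ and $\mathbb{Z}_n$ is the cyclic group of order $n$. *)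

theory Defs
  imports
    "HOL-Algebra.Elementary_Groups"
    "HOL-Computational_Algebra.Primes"
    "Graph_Theory.Pair_Digraph"
    "Graph_Theory.Digraph_Isomorphism"
    "Graph_Theory.Kuratowski"
begin

text \<open>
  As in the theory \<^theory>\<open>Graph_Theory.Digraph\<close>, an undirected graph is a symmetric digraph:
  an edge \<open>{x, y}\<close> is the pair of arcs \<open>(x, y)\<close> and \<open>(y, x)\<close>.
\<close>

definition power_graph :: "('a, 'b) monoid_scheme \<Rightarrow> 'a pair_pre_digraph" where
  "power_graph G =
     \<lparr> pverts = carrier G,
       parcs = {(x, y). x \<in> carrier G \<and> y \<in> carrier G \<and> x \<noteq> y \<and>
                        (x \<in> generate G {y} \<or> y \<in> generate G {x})} \<rparr>"

lemma pair_graph_power_graph: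
  assumes "finite (carrier G)"
  shows "pair_graph (power_graph G)"
proof -
  have "parcs (power_graph G) \<subseteq> carrier G \<times> carrier G"
    by (auto simp: power_graph_def)
  then have "finite (parcs (power_graph G))"
    using assms by (meson finite_SigmaI finite_subset)
  then show ?thesis
    using assms
    by unfold_locales (auto simp: power_graph_def symmetric_def intro!: symI)
qed

definition induced_free :: "('c, 'd) pre_digraph \<Rightarrow> ('a, 'b) pre_digraph \<Rightarrow> bool" where
  "induced_free \<Gamma> G \<longleftrightarrow> \<not> (\<exists>H. induced_subgraph H G \<and> digraph_iso H \<Gamma>)"

text \<open>
  Graph_Theory only has the predicate \<^const>\<open>complete_bipartite_digraph\<close>; this is a concrete
  representative of $K_{m,n}$.
\<close>

definition complete_bipartite_graph :: "nat \<Rightarrow> nat \<Rightarrow> (nat + nat) pair_pre_digraph" where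
  "complete_bipartite_graph m n =
     (let U = Inl ` {..<m}; V = Inr ` {..<n}
      in \<lparr> pverts = U \<union> V, parcs = U \<times> V \<union> V \<times> U \<rparr>)"

lemma complete_bipartite_graph:
  "complete_bipartite_digraph m n (with_proj (complete_bipartite_graph m n))"
proof -
  let ?U = "Inl ` {..<m} :: (nat + nat) set" and ?V = "Inr ` {..<n} :: (nat + nat) set"
  have "?U \<inter> ?V = {}" "card ?U = m" "card ?V = n"
    by (auto simp: card_image)
  then show ?thesis
    unfolding complete_bipartite_digraph_pair_def complete_bipartite_graph_def Let_def
    by (intro conjI exI[of _ ?U] exI[of _ ?V]) simp_all
qed

text \<open>
  The quadruple \<open>(a, b, c, d)\<close> stands for the integral Hamilton quaternion $a + bi + cj + dk$, and
  $Q_8 = \{\pm 1, \pm i, \pm j, \pm k\}$ under quaternion multiplication.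
\<close>

type_synonym quat = "int \<times> int \<times> int \<times> int"

fun quat_mult :: "quat \<Rightarrow> quat \<Rightarrow> quat" where
  "quat_mult (a, b, c, d) (a', b', c', d') =
     (a * a' - b * b' - c * c' - d * d',
      a * b' + b * a' + c * d' - d * c',
      a * c' - b * d' + c * a' + d * b',
      a * d' + b * c' - c * b' + d * a')"

definition Q8 :: "quat monoid" where
  "Q8 = \<lparr> carrier = {( 1, 0, 0, 0), ( 0, 1, 0, 0), ( 0, 0, 1, 0), ( 0, 0, 0, 1),
                     (-1, 0, 0, 0), ( 0,-1, 0, 0), ( 0, 0,-1, 0), ( 0, 0, 0,-1)},
          monoid.mult = quat_mult,
          one = (1, 0, 0, 0) \<rparr>"

lemma quat_mult_assoc: "quat_mult (quat_mult x y) z = quat_mult x (quat_mult y z)"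
  by (cases x; cases y; cases z) (simp add: algebra_simps)

lemma group_Q8: "group Q8"
proof (rule groupI)
  fix x y assume "x \<in> carrier Q8" "y \<in> carrier Q8"
  then show "x \<otimes>\<^bsub>Q8\<^esub> y \<in> carrier Q8"
    by (auto simp: Q8_def)
qed (auto simp: Q8_def quat_mult_assoc)

lemma order_Q8: "order Q8 = 8"
  by (simp add: Q8_def order_def)

end

theory Submission
  imports Defs "HOL-Algebra.Multiplicative_Group"
begin

text \<open>
  The identity is adjacent to every other vertex of the power graph, so an induced $K_{1,n}$ with
  $n \neq 1$ exists iff there are \<open>n\<close> pairwise incomparable elements, where \<open>x\<close> is below \<open>y\<close> if
  \<open>x \<in> \<langle>y\<rangle>\<close>.

  In a cyclic group of order \<open>n\<close> comparability is divisibility of orders, and the divisor lattice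
  of \<open>n\<close> has no antichain of size 4 iff \<open>n\<close> is $pqr$ or $p^m q^k$ with $\min(m, k) \le 2$.
  If a noncyclic group has no antichain of size 4, take generators \<open>a\<close>, \<open>b\<close> of two distinct maximal
  cyclic subgroups and a generator \<open>c\<close> of a maximal cyclic subgroup containing \<open>ab\<close>; these three
  subgroups cover the group. They then meet pairwise in the same central subgroup
  \<open>\<langle>a\<^sup>2\<rangle> = \<langle>b\<^sup>2\<rangle> = \<langle>c\<^sup>2\<rangle>\<close>, whose order turns out to be 1 (Klein four-group) or 2 (\<open>Q\<^sub>8\<close>).
\<close>

section \<open>Induced stars in the power graph\<close>

text \<open>As both orders of a pair are covered, one implication excludes comparability in either
  direction; these are the independent sets of \<open>power_graph G\<close>.\<close>

definition power_antichain :: "('a, 'b) monoid_scheme \<Rightarrow> 'a set \<Rightarrow> bool" where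
  "power_antichain G S \<longleftrightarrow>
     S \<subseteq> carrier G \<and> (\<forall>x\<in>S. \<forall>y\<in>S. x \<in> generate G {y} \<longrightarrow> x = y)"

text \<open>An antichain containing \<open>\<one>\<close> is \<open>{\<one>}\<close>, so for
  \<open>n \<noteq> 1\<close> the identity is free to be the centre of the star. Conversely, the
  leaves of any induced star, whatever its centre, form an antichain.\<close>

lemma (in group) induced_free_power_graph_iff:
  assumes "finite (carrier G)" and "n \<noteq> 1"
  shows "induced_free (with_proj (complete_bipartite_graph 1 n)) (with_proj (power_graph G)) \<longleftrightarrow>
    \<not> (\<exists>S. power_antichain G S \<and> card S = n)"
proof -
  let ?K = "complete_bipartite_graph 1 n" and ?P = "power_graph G"
  interpret P: pair_graph ?P by (rule pair_graph_power_graph) fact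
  have verts_K: "pverts ?K = insert (Inl 0) (Inr ` {..<n})"
    and arcs_K: "parcs ?K = {Inl 0} \<times> Inr ` {..<n} \<union> Inr ` {..<n} \<times> {Inl 0}"
    by (auto simp: complete_bipartite_graph_def Let_def)
  show ?thesis
  proof
    assume free: "induced_free (with_proj ?K) (with_proj ?P)"
    show "\<not> (\<exists>S. power_antichain G S \<and> card S = n)"
    proof
      assume "\<exists>S. power_antichain G S \<and> card S = n"
      then obtain S where S: "power_antichain G S" "card S = n" by blast
      have one: "\<one> \<notin> S"
      proof
        assume "\<one> \<in> S"
        then have "S = {\<one>}"
          using S(1) generate.one[of G] by (auto simp: power_antichain_def)
        then show False using S(2) \<open>n \<noteq> 1\<close> by simp
      qed
      have sub: "S \<subseteq> carrier G" using S(1) by (simp add: power_antichain_def)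
      have "finite S" using sub assms(1) by (rule finite_subset)
      then obtain h where h: "bij_betw h S {..<n}"
        using ex_bij_betw_finite_nat[of S] S(2) by (auto simp: atLeast0LessThan)
      \<comment> \<open>The star with centre \<open>\<one>\<close> and leaves \<open>S\<close>;
        \<open>f\<close> sends the centre to \<open>Inl 0\<close> and numbers the leaves through
        \<open>h\<close>.\<close>
      define H where
        "H = \<lparr> pverts = insert \<one> S, parcs = {\<one>} \<times> S \<union> S \<times> {\<one>} \<rparr>"
      define f where "f x = (if x = \<one> then Inl 0 else Inr (h x) :: nat + nat)" for x
      define F where "F = \<lparr> iso_verts = f, iso_arcs = map_prod f f,
        iso_head = snd, iso_tail = fst \<rparr>"
      have f_one: "f \<one> = Inl 0" by (simp add: f_def)
      have f_S: "f ` S = Inr ` {..<n}"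
        using h one by (auto simp: f_def bij_betw_def image_iff)
      have inj: "inj_on f (insert \<one> S)"
        using h one by (auto simp: inj_on_def f_def bij_betw_def)
      have wf: "wf_digraph (with_proj H)"
        by unfold_locales (auto simp: H_def)
      have "pre_digraph.digraph_isomorphism (with_proj H) F"
        unfolding pre_digraph.digraph_isomorphism_def
        using inj map_prod_inj_on[OF inj inj] wf
        by (auto simp: F_def H_def elim!: inj_on_subset)
      moreover have "with_proj ?K = app_iso F (with_proj H)"
      proof -
        have "map_prod f f ` ({\<one>} \<times> S \<union> S \<times> {\<one>}) = {f \<one>} \<times> f ` S \<union> f ` S \<times> {f \<one>}"
          by (auto simp: image_iff)
        then show ?thesis
          unfolding app_iso_def with_proj_def verts_K arcs_K
          using f_S f_one by (simp add: F_def H_def)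
      qed
      moreover have "x \<notin> generate G {y}" if "x \<in> S" "y \<in> S" "x \<noteq> y" for x y
        using S(1) that by (auto simp: power_antichain_def)
      then have "induced_subgraph (with_proj H) (with_proj ?P)"
        unfolding induced_subgraph_def subgraph_def
        using wf P.wf_digraph sub S(1) one generate.one[of G]
        by (auto simp: H_def power_graph_def compatible_def)
      ultimately show False
        using free by (auto simp: induced_free_def digraph_iso_def)
    qed
  next
    assume none: "\<not> (\<exists>S. power_antichain G S \<and> card S = n)"
    show "induced_free (with_proj ?K) (with_proj ?P)"
      unfolding induced_free_def
    proof
      assume "\<exists>H. induced_subgraph H (with_proj ?P) \<and> digraph_iso H (with_proj ?K)"
      then obtain H F where H: "induced_subgraph H (with_proj ?P)"
        and F: "pre_digraph.digraph_isomorphism H F" and K: "with_proj ?K = app_iso F H"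
        unfolding digraph_iso_def by blast
      define f where "f = iso_verts F"
      have inj: "inj_on f (verts H)"
        and arcs: "\<And>e. e \<in> arcs H \<Longrightarrow> f (tail H e) = iso_tail F (iso_arcs F e) \<and>
            f (head H e) = iso_head F (iso_arcs F e)"
        using F by (auto simp: pre_digraph.digraph_isomorphism_def f_def)
      have verts_H: "f ` verts H = pverts ?K" and arcs_H: "iso_arcs F ` arcs H = parcs ?K"
        and ends: "iso_tail F = fst" "iso_head F = snd"
        using K by (simp_all add: app_iso_def with_proj_def f_def)
      have sub: "verts H \<subseteq> carrier G"
        and tl: "tail H = fst" "head H = snd"
        and ind: "arcs H = {e \<in> parcs ?P. fst e \<in> verts H \<and> snd e \<in> verts H}"
        using H by (auto simp: induced_subgraph_def subgraph_def compatible_def power_graph_def)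
      \<comment> \<open>The leaves are pulled back along the isomorphism; an arc between two of them
        would map to an arc between two \<open>Inr\<close> vertices.\<close>
      define S where "S = {v \<in> verts H. f v \<in> Inr ` {..<n}}"
      have no_arc: "(x, y) \<notin> arcs H" if "x \<in> S" "y \<in> S" for x y
      proof
        assume e: "(x, y) \<in> arcs H"
        then have "iso_arcs F (x, y) \<in> parcs ?K" using arcs_H by blast
        moreover have "iso_arcs F (x, y) = (f x, f y)"
          using arcs[OF e] by (simp add: ends tl prod_eq_iff)
        ultimately show False using that unfolding arcs_K by (auto simp: S_def)
      qed
      have *: "x = y" if "x \<in> S" "y \<in> S" "x \<in> generate G {y} \<or> y \<in> generate G {x}" for x y
        using no_arc[OF that(1,2)] that sub unfolding ind
        by (auto simp: power_graph_def S_def)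
      have "power_antichain G S"
        using * sub by (auto simp: power_antichain_def S_def)
      moreover have "card S = n"
      proof -
        have "f ` S = Inr ` {..<n}"
        proof -
          have "f ` S = f ` verts H \<inter> Inr ` {..<n}" by (auto simp: S_def)
          then show ?thesis unfolding verts_H verts_K by auto
        qed
        moreover have "inj_on f S"
          using inj by (rule inj_on_subset) (auto simp: S_def)
        ultimately have "card S = card (Inr ` {..<n} :: (nat + nat) set)"
          by (metis card_image)
        then show ?thesis by (simp add: card_image)
      qed
      ultimately show False using none by blast
    qed
  qed
qed

section \<open>Antichains of divisors\<close>

lemma coprime_part_decompose:
  fixes p n :: nat
  assumes "prime p" and "n > 0"
  obtains k m where "n = p ^ k * m" and "\<not> p dvd m" and "m > 0"
proof -
  have "n \<noteq> 0" "\<not> is_unit p" using assms by auto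
  then obtain m where "n = p ^ multiplicity p n * m" "\<not> p dvd m"
    by (rule multiplicity_decompose')
  then show thesis using that \<open>n > 0\<close> by (metis gr0I mult_0_right nat_less_le)
qed

lemma prime_dvd_imp_eq:
  fixes p q :: nat
  assumes "prime p" and "prime q"
  shows "p dvd q \<longleftrightarrow> p = q"
  using primes_dvd_imp_eq[OF assms] by auto

text \<open>For each excluded \<open>n\<close> the antichain consists of four divisors with the same number of prime
  factors, counted with multiplicity.\<close>

lemma no_divisor_antichain_of_card_4:
  fixes n :: nat
  assumes "n > 0"
    and none: "\<forall>D. (\<forall>d\<in>D. d dvd n) \<and> (\<forall>d\<in>D. \<forall>e\<in>D. d dvd e \<longrightarrow> d = e) \<longrightarrow> card D \<noteq> 4"
  shows "(\<exists>p q r. prime p \<and> prime q \<and> prime r \<and> p \<noteq> q \<and> p \<noteq> r \<and> q \<noteq> r \<and> n = p * q * r)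
    \<or> (\<exists>p q m k. prime p \<and> prime q \<and> p \<noteq> q \<and> {m, k} \<inter> {0, 1, 2} \<noteq> {} \<and> n = p ^ m * q ^ k)"
proof -
  have none4: False
    if "a dvd n" "b dvd n" "c dvd n" "d dvd n"
      "\<not> a dvd b" "\<not> a dvd c" "\<not> a dvd d" "\<not> b dvd a" "\<not> b dvd c" "\<not> b dvd d"
      "\<not> c dvd a" "\<not> c dvd b" "\<not> c dvd d" "\<not> d dvd a" "\<not> d dvd b" "\<not> d dvd c"
    for a b c d
  proof -
    have "card {a, b, c, d} = 4" using that by (auto simp: card_insert_if)
    moreover have "\<forall>x\<in>{a, b, c, d}. x dvd n" using that(1-4) by simp
    moreover have "\<forall>x\<in>{a, b, c, d}. \<forall>y\<in>{a, b, c, d}. x dvd y \<longrightarrow> x = y"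
      using that(5-) by simp
    ultimately show False using none by blast
  qed
  show ?thesis
  proof (cases "\<exists>p q r. prime p \<and> prime q \<and> prime r \<and> p \<noteq> q \<and> p \<noteq> r \<and> q \<noteq> r
      \<and> p dvd n \<and> q dvd n \<and> r dvd n")
    case True
    then obtain p q r where pr: "prime p" "prime q" "prime r" and ne: "p \<noteq> q" "p \<noteq> r" "q \<noteq> r"
      and dvd: "p dvd n" "q dvd n" "r dvd n" by blast
    \<comment> \<open>A repeated prime: the divisors \<open>p * p\<close>, \<open>p * q\<close>,
      \<open>p * r\<close>, \<open>q * r\<close> form an antichain.\<close>
    have sq: False if "prime p" "prime q" "prime r" "p \<noteq> q" "p \<noteq> r" "q \<noteq> r"
        "p * (p * q * r) dvd n" for p q r
    proof -
      have nd: "\<not> p dvd q * r" "\<not> q dvd r" "\<not> r dvd q" "p \<noteq> 0" "q \<noteq> 0" "r \<noteq> 0"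
        "\<not> q dvd p" "\<not> r dvd p" "\<not> p dvd q" "\<not> p dvd r"
        using that by (auto simp: prime_dvd_mult_iff prime_dvd_imp_eq)
      have d: "p * p dvd n" "p * q dvd n" "p * r dvd n" "q * r dvd n"
        using dvd_trans[OF _ that(7)] by (auto simp: mult_ac)
      have q1: "\<not> q dvd p * p" "\<not> r dvd p * p" "\<not> q dvd p * r" "\<not> r dvd p * q"
        using nd that by (auto simp: prime_dvd_mult_iff)
      have "\<not> p * p dvd p * q" "\<not> p * p dvd p * r" "\<not> p * q dvd p * p" "\<not> p * q dvd p * r"
        "\<not> p * r dvd p * p" "\<not> p * r dvd p * q"
        using nd by auto
      moreover have "\<not> p * p dvd q * r" "\<not> p * q dvd q * r" "\<not> p * r dvd q * r"
        using nd(1) dvd_mult_left by blast+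
      moreover have "\<not> q * r dvd p * p" "\<not> q * r dvd p * r"
        using q1(1,3) dvd_mult_left by blast+
      moreover have "\<not> q * r dvd p * q"
        using q1(4) dvd_mult_right by blast
      ultimately show False
        using none4[OF d] by blast
    qed
    have "coprime p q" "coprime p r" "coprime q r"
      using pr ne by (auto simp: primes_coprime)
    then have "p * q * r dvd n" using dvd
      by (simp add: coprime_commute divides_mult)
    then obtain s where s: "n = p * q * r * s" by blast
    have "s = 1"
    proof (rule ccontr)
      assume "s \<noteq> 1"
      then obtain t where t: "prime t" "t dvd s" using prime_factor_nat by blast
      then obtain s' where s': "n = p * q * r * (t * s')" using s by auto
      \<comment> \<open>The prime \<open>t\<close> either repeats one of the three, which
        \<open>sq\<close> excludes, or \<open>p\<close>, \<open>q\<close>, \<open>r\<close>,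
        \<open>t\<close> form an antichain.\<close>
      show False
      proof (cases "t \<in> {p, q, r}")
        case True
        then show False
          using sq[of p q r] sq[of q p r] sq[of r p q] pr ne s' by (auto simp: mult_ac)
      next
        case False
        then show False
          using none4[OF dvd dvd_trans[of t s n]] t s pr ne by (auto simp: prime_dvd_imp_eq)
      qed
    qed
    then show ?thesis using s pr ne by auto
  next
    case False
    \<comment> \<open>Prime divisors are chosen where they exist and arbitrary primes otherwise; the
      latter get exponent 0, so that 1 and prime powers also take the form
      \<open>p ^ m * q ^ k\<close>.\<close>
    obtain p where p: "prime p" "p dvd n \<or> (\<forall>t. prime t \<longrightarrow> \<not> t dvd n)"
      using two_is_prime_nat by metis
    obtain q0 where q0: "prime q0" "p < q0" using bigger_prime by blast
    obtain q where q: "prime q" "p \<noteq> q" "q dvd n \<or> (\<forall>t. prime t \<longrightarrow> t dvd n \<longrightarrow> t = p)"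
    proof (cases "\<forall>t. prime t \<longrightarrow> t dvd n \<longrightarrow> t = p")
      case True
      then show ?thesis using that[of q0] q0 by auto
    next
      case False
      then show ?thesis using that by metis
    qed
    have only: "t = p \<or> t = q" if "prime t" "t dvd n" for t
      using that p q False by blast
    note pq = p(1) q(1,2)
    obtain m n' where n': "n = p ^ m * n'" "\<not> p dvd n'" "n' > 0"
      using coprime_part_decompose[OF pq(1) \<open>n > 0\<close>] by blast
    obtain k n'' where n'': "n' = q ^ k * n''" "\<not> q dvd n''" "n'' > 0"
      using coprime_part_decompose[OF pq(2) n'(3)] by blast
    have "n'' = 1"
    proof (rule ccontr)
      assume "n'' \<noteq> 1"
      then obtain t where "prime t" "t dvd n''" using prime_factor_nat by blast
      then show False using only[of t] n' n'' by auto
    qed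
    then have n: "n = p ^ m * q ^ k" using n' n'' by simp
    have "m \<le> 2 \<or> k \<le> 2"
    proof (rule ccontr)
      assume "\<not> (m \<le> 2 \<or> k \<le> 2)"
      then have mk: "m \<ge> 3" "k \<ge> 3" by auto
      have eq: "p ^ i * q ^ j dvd p ^ i' * q ^ j' \<longleftrightarrow> i \<le> i' \<and> j \<le> j'" for i j i' j'
      proof
        assume *: "p ^ i * q ^ j dvd p ^ i' * q ^ j'"
        have cop: "coprime (p ^ a) (q ^ b)" "coprime (q ^ a) (p ^ b)" for a b
          using pq by (auto simp: primes_coprime)
        have "p ^ i dvd p ^ i'" "q ^ j dvd q ^ j'"
          using * cop by (metis coprime_dvd_mult_left_iff dvd_mult_left,
              metis coprime_dvd_mult_right_iff dvd_mult_right)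
        then show "i \<le> i' \<and> j \<le> j'"
          using pq(1,2) by (meson power_dvd_imp_le prime_gt_1_nat)
      qed (auto intro: mult_dvd_mono le_imp_power_dvd)
      \<comment> \<open>The exponent pairs (3,0), (2,1), (1,2), (0,3) are incomparable and lie below
        \<open>(m, k)\<close> once both exponents are at least 3.\<close>
      show False
        using none4[of "p ^ 3 * q ^ 0" "p ^ 2 * q ^ 1" "p ^ 1 * q ^ 2" "p ^ 0 * q ^ 3"] mk
        unfolding n eq by simp
    qed
    then have "{m, k} \<inter> {0, 1, 2} \<noteq> {}"
      by (auto simp: le_Suc_eq numeral_2_eq_2)
    then show ?thesis using pq n by blast
  qed
qed

text \<open>Colour \<open>d\<close> by the exponent of \<open>q\<close>: at most
  \<open>k + 1 \<le> 3\<close> colours occur, and divisors with the same exponent of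
  \<open>q\<close> are ordered by their exponent of \<open>p\<close>. Such a cover by three chains
  bounds antichains by three.\<close>

lemma divisor_chain_cover_two_primes:
  fixes p q :: nat
  assumes "prime p" and "prime q" and "p \<noteq> q" and "k \<le> 2"
  obtains c :: "nat \<Rightarrow> nat" where
    "\<And>d. d dvd p ^ m * q ^ k \<Longrightarrow> c d < 3"
    "\<And>d e. d dvd p ^ m * q ^ k \<Longrightarrow> e dvd p ^ m * q ^ k \<Longrightarrow> c d = c e \<Longrightarrow> d dvd e \<or> e dvd d"
proof
  have form: "\<exists>i j. j \<le> k \<and> d = p ^ i * q ^ j" if d: "d dvd p ^ m * q ^ k" for d
  proof -
    obtain a b where ab: "d = a * b" "a dvd p ^ m" "b dvd q ^ k"
      using division_decomp[OF d] by blast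
    obtain i where "a = p ^ i" using ab(2) divides_primepow_nat[OF assms(1)] by blast
    moreover obtain j where "j \<le> k" "b = q ^ j"
      using ab(3) divides_primepow_nat[OF assms(2)] by blast
    ultimately show ?thesis using ab(1) by blast
  qed
  have mult: "multiplicity q (p ^ i * q ^ j) = j" for i j
  proof (rule multiplicity_eqI)
    have "\<not> q dvd p ^ i"
      using assms by (metis prime_dvd_power prime_dvd_imp_eq)
    then show "\<not> q ^ Suc j dvd p ^ i * q ^ j"
      using assms(2) by (simp add: prime_gt_0_nat)
  qed simp
  show "multiplicity q d < 3" if d: "d dvd p ^ m * q ^ k" for d
  proof -
    obtain i j where "j \<le> k" "d = p ^ i * q ^ j" using form[OF d] by blast
    then show ?thesis using assms(4) by (simp add: mult)
  qed
  show "d dvd e \<or> e dvd d"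
    if d: "d dvd p ^ m * q ^ k" and e: "e dvd p ^ m * q ^ k"
      and eq: "multiplicity q d = multiplicity q e" for d e
  proof -
    obtain i j i' j' where "d = p ^ i * q ^ j" "e = p ^ i' * q ^ j'"
      using form[OF d] form[OF e] by blast
    moreover from this have "j = j'" using eq by (simp add: mult)
    ultimately show ?thesis
      by (cases "i \<le> i'") (simp_all add: le_imp_power_dvd mult_dvd_mono)
  qed
qed

text \<open>The eight divisors split into the chains \<open>1, p, p * q, p * q * r\<close>, then
  \<open>q, q * r\<close>, and \<open>r, p * r\<close>, with colours 0, 1 and 2.\<close>

lemma divisor_chain_cover_three_primes:
  fixes p q r :: nat
  assumes "prime p" and "prime q" and "prime r" and "p \<noteq> q" and "p \<noteq> r" and "q \<noteq> r"
  obtains c :: "nat \<Rightarrow> nat" where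
    "\<And>d. d dvd p * q * r \<Longrightarrow> c d < 3"
    "\<And>d e. d dvd p * q * r \<Longrightarrow> e dvd p * q * r \<Longrightarrow> c d = c e \<Longrightarrow> d dvd e \<or> e dvd d"
proof
  define c :: "nat \<Rightarrow> nat" where
    "c d = (if p dvd d \<and> q dvd d \<or> \<not> q dvd d \<and> \<not> r dvd d then 0 else if q dvd d then 1 else 2)" for d
  show "c d < 3" for d by (simp add: c_def)
  have form: "d \<in> {1, p, p * q, p * q * r, q, q * r, r, p * r}" if d: "d dvd p * q * r" for d
  proof -
    obtain a b where ab: "d = a * b" "a dvd p * q" "b dvd r" using division_decomp[OF d] by blast
    obtain x y where "a = x * y" "x dvd p" "y dvd q" using division_decomp[OF ab(2)] by blast
    moreover from this ab(3) have "x = 1 \<or> x = p" "y = 1 \<or> y = q" "b = 1 \<or> b = r"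
      using assms(1-3) by (auto simp: prime_nat_iff)
    ultimately show ?thesis using ab(1) by auto
  qed
  show "d dvd e \<or> e dvd d" if "d dvd p * q * r" "e dvd p * q * r" "c d = c e" for d e
    using form[OF that(1)] form[OF that(2)] that(3) assms
    by (auto simp: c_def prime_dvd_mult_iff prime_dvd_imp_eq)
qed

section \<open>Antichains in the listed groups and in cyclic groups\<close>

lemma (in group) power_antichain_iso:
  assumes "group H" and h: "h \<in> iso G H" and S: "power_antichain G S"
  shows "power_antichain H (h ` S)" and "card (h ` S) = card S"
proof -
  interpret h: group_hom G H h
    using assms(1,2) by (simp add: group_hom_def group_hom_axioms_def iso_imp_homomorphism)
  have inj: "inj_on h (carrier G)" and im: "h ` carrier G = carrier H"
    using h by (auto simp: iso_iff)
  have sub: "S \<subseteq> carrier G" using S by (simp add: power_antichain_def)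
  show "card (h ` S) = card S"
    using inj sub by (meson card_image inj_on_subset)
  have "x \<in> generate G {y}" if xy: "x \<in> S" "y \<in> S" "h x \<in> generate H {h y}" for x y
  proof -
    have "h ` generate G {y} = generate H (h ` {y})"
      using h.generate_img[of "{y}"] sub xy(2) by auto
    then obtain x' where "x' \<in> generate G {y}" "h x = h x'"
      using xy(3) by auto
    moreover have "generate G {y} \<subseteq> carrier G"
      using sub xy(2) by (intro generate_incl) auto
    ultimately show ?thesis using inj sub xy(1) by (metis inj_onD subsetD)
  qed
  then show "power_antichain H (h ` S)"
    using S im sub by (auto simp: power_antichain_def)
qed

lemma (in group) no_power_antichain_of_iso:
  assumes "group H" and "G \<cong> H" and "\<not> (\<exists>T. power_antichain H T \<and> card T = k)"
  shows "\<not> (\<exists>S. power_antichain G S \<and> card S = k)"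
  using assms power_antichain_iso[OF assms(1)] unfolding is_iso_def by (metis ex_in_conv)

text \<open>Pigeonhole: each colour class is a chain, so it contains at most one element of an
  antichain.\<close>

lemma card_power_antichain_le:
  assumes "power_antichain G S"
    and "\<And>x. x \<in> carrier G \<Longrightarrow> c x < k"
    and "\<And>x y. \<lbrakk>x \<in> carrier G; y \<in> carrier G; c x = c y\<rbrakk>
           \<Longrightarrow> x \<in> generate G {y} \<or> y \<in> generate G {x}"
  shows "card S \<le> (k::nat)"
proof -
  have sub: "S \<subseteq> carrier G"
    and anti: "\<And>x y. \<lbrakk>x \<in> S; y \<in> S; x \<in> generate G {y}\<rbrakk> \<Longrightarrow> x = y"
    using assms(1) by (auto simp: power_antichain_def)
  have "inj_on c S"
    using assms(3) anti sub by (intro inj_onI) (metis subsetD)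
  moreover have "c ` S \<subseteq> {..<k}"
    using assms(2) sub by auto
  ultimately show ?thesis
    by (metis card_inj_on_le card_lessThan finite_lessThan)
qed

lemma card_power_antichain_Q8_le:
  assumes "power_antichain Q8 S"
  shows "card S \<le> 3"
proof (rule card_power_antichain_le[OF assms])
  interpret group Q8 by (rule group_Q8)
  \<comment> \<open>One colour for each cyclic subgroup of order 4: colour 0 is 1, -1, i, -i, colour
    1 is j, -j, and colour 2 is k, -k.\<close>
  define c :: "quat \<Rightarrow> nat" where
    "c = (\<lambda>(w, x, y, z). if y \<noteq> 0 then 1 else if z \<noteq> 0 then 2 else 0)"
  show "c x < 3" for x by (simp add: c_def split: prod.split)
  \<comment> \<open>Orders in \<open>Q8\<close> divide 4, so these powers exhaust
    \<open>generate Q8 {x}\<close> and comparability becomes a finite check of products.\<close>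
  have pow: "{\<one>\<^bsub>Q8\<^esub>, x, x \<otimes>\<^bsub>Q8\<^esub> x, x \<otimes>\<^bsub>Q8\<^esub> (x \<otimes>\<^bsub>Q8\<^esub> x)} \<subseteq> generate Q8 {x}" if "x \<in> carrier Q8" for x
    using generate.eng[OF generate.incl generate.incl, of x "{x}" x Q8]
      generate.eng[OF generate.incl generate.eng[OF generate.incl generate.incl], of x "{x}" x x Q8]
    by (simp add: generate.one generate.incl)
  have "\<forall>x\<in>carrier Q8. \<forall>y\<in>carrier Q8. c x = c y \<longrightarrow>
      x \<in> {\<one>\<^bsub>Q8\<^esub>, y, y \<otimes>\<^bsub>Q8\<^esub> y, y \<otimes>\<^bsub>Q8\<^esub> (y \<otimes>\<^bsub>Q8\<^esub> y)} \<or>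
      y \<in> {\<one>\<^bsub>Q8\<^esub>, x, x \<otimes>\<^bsub>Q8\<^esub> x, x \<otimes>\<^bsub>Q8\<^esub> (x \<otimes>\<^bsub>Q8\<^esub> x)}"
    by (simp add: Q8_def c_def)
  then show "x \<in> generate Q8 {y} \<or> y \<in> generate Q8 {x}"
    if "x \<in> carrier Q8" "y \<in> carrier Q8" "c x = c y" for x y
    using pow that by blast
qed

text \<open>By Bezout \<open>gcd y n\<close> is a multiple of \<open>y\<close> modulo
  \<open>n\<close>, so every multiple of this gcd lies in the subgroup generated by
  \<open>y\<close>.\<close>

lemma in_generate_integer_mod_group:
  assumes "n > 0" and "x \<in> carrier (integer_mod_group n)" and "y \<in> carrier (integer_mod_group n)"
    and "gcd y (int n) dvd x"
  shows "x \<in> generate (integer_mod_group n) {y}"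
proof -
  interpret group "integer_mod_group n" by simp
  obtain u v where uv: "u * y + v * int n = gcd y (int n)" using bezout_int by blast
  obtain w where w: "x = gcd y (int n) * w" using assms(4) by blast
  have "w * u * y = x + int n * (- (w * v))"
    unfolding w uv[symmetric] by (simp add: algebra_simps)
  then have "(w * u * y) mod int n = x mod int n" by (metis mod_mult_self2)
  also have "\<dots> = x" using assms(1,2) by (simp add: carrier_integer_mod_group)
  finally have "x = y [^]\<^bsub>integer_mod_group n\<^esub> (w * u)"
    by (simp add: int_pow_integer_mod_group)
  then show ?thesis using generate_pow[OF assms(3)] by blast
qed

text \<open>Divisibility between the divisors \<open>gcd x n\<close> and \<open>gcd y n\<close>
  makes \<open>x\<close> and \<open>y\<close> comparable, so a chain cover of the divisors pulls
  back to the group.\<close>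

lemma card_power_antichain_integer_mod_group_le:
  fixes c :: "nat \<Rightarrow> nat"
  assumes "n > 0" and S: "power_antichain (integer_mod_group n) S"
    and c: "\<And>d. d dvd n \<Longrightarrow> c d < 3"
    "\<And>d e. d dvd n \<Longrightarrow> e dvd n \<Longrightarrow> c d = c e \<Longrightarrow> d dvd e \<or> e dvd d"
  shows "card S \<le> 3"
proof (rule card_power_antichain_le[OF S, where c = "\<lambda>x. c (nat (gcd x (int n)))"])
  let ?d = "\<lambda>x. nat (gcd x (int n))"
  have dvd: "?d x dvd n" for x by (simp add: nat_dvd_iff)
  show "c (?d x) < 3" for x by (rule c(1)[OF dvd])
  show "x \<in> generate (integer_mod_group n) {y} \<or> y \<in> generate (integer_mod_group n) {x}"
    if "x \<in> carrier (integer_mod_group n)" "y \<in> carrier (integer_mod_group n)"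
      "c (?d x) = c (?d y)" for x y
  proof -
    have "?d x dvd ?d y \<or> ?d y dvd ?d x" by (rule c(2)[OF dvd dvd that(3)])
    then have "gcd x (int n) dvd y \<or> gcd y (int n) dvd x"
      by (auto simp: nat_dvd_iff)
    then show ?thesis using in_generate_integer_mod_group[OF \<open>n > 0\<close>] that(1,2) by blast
  qed
qed

section \<open>Cyclic subgroups and cyclic groups\<close>

context group
begin

lemma generate_self: "x \<in> generate G {x}"
  by (simp add: generate.incl)

lemma generate_singleton_subgroup: "x \<in> carrier G \<Longrightarrow> subgroup (generate G {x}) G"
  by (simp add: generate_is_subgroup)

lemma generate_singleton_mono:
  assumes "y \<in> carrier G" and "x \<in> generate G {y}"
  shows "generate G {x} \<subseteq> generate G {y}"
  using assms generate_subgroup_incl[of "{x}" "generate G {y}"] generate_singleton_subgroup by simp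

lemma subgroup_mult_mem_iff:
  assumes "subgroup H G" and "x \<in> H" and "y \<in> carrier G"
  shows "x \<otimes> y \<in> H \<longleftrightarrow> y \<in> H" and "y \<otimes> x \<in> H \<longleftrightarrow> y \<in> H"
proof -
  interpret H: subgroup H G by fact
  have x: "x \<in> carrier G" using assms(2) by (rule H.mem_carrier)
  have l: "inv x \<otimes> (x \<otimes> y) = y" using x assms(3) by (simp flip: m_assoc)
  have r: "y \<otimes> x \<otimes> inv x = y" using x assms(3) by (simp add: m_assoc)
  show "x \<otimes> y \<in> H \<longleftrightarrow> y \<in> H"
    using H.m_closed[of "inv x" "x \<otimes> y"] l assms(2) by auto
  show "y \<otimes> x \<in> H \<longleftrightarrow> y \<in> H"
    using H.m_closed[of "y \<otimes> x" "inv x"] r assms(2) by auto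
qed

lemma ord_dvd_of_mem_generate:
  assumes "finite (carrier G)" and "x \<in> carrier G" and "y \<in> generate G {x}"
  shows "ord y dvd ord x"
proof -
  obtain k :: nat where "y = x [^] k"
    using assms generate_pow_on_finite_carrier by blast
  then have "y [^] ord x = \<one>"
    using assms(2) by (metis mult.commute nat_pow_one nat_pow_pow pow_ord_eq_1)
  then show ?thesis
    using \<open>y = x [^] k\<close> assms(2) by (simp add: pow_eq_id)
qed

lemma cyclic_iso_integer_mod_group:
  assumes "finite (carrier G)" and "g \<in> carrier G" and "generate G {g} = carrier G"
  shows "G \<cong> integer_mod_group (order G)"
proof -
  let ?n = "order G" and ?h = "\<lambda>i::int. g [^] i"
  have ord: "ord g = ?n" using assms(2,3) by (simp add: generate_pow_card order_def)
  have n: "?n > 0" using assms(1) by (simp add: order_gt_0_iff_finite)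
  have eq: "g [^] i = g [^] j \<longleftrightarrow> i mod int ?n = j mod int ?n" for i j :: int
    unfolding int_pow_eq[OF assms(2)] ord by (metis mod_eq_dvd_iff)
  have "?h \<in> hom (integer_mod_group ?n) G"
    using assms(2) by (intro homI) (auto simp: int_pow_mult[symmetric] eq)
  moreover have "inj_on ?h (carrier (integer_mod_group ?n))"
    using n by (auto simp: inj_on_def eq carrier_integer_mod_group)
  moreover have "?h ` carrier (integer_mod_group ?n) = carrier G"
  proof -
    have "carrier G = range ?h"
      using generate_pow[OF assms(2)] assms(3) by auto
    moreover have "g [^] i \<in> ?h ` {0..<int ?n}" for i :: int
      using n by (intro image_eqI[of _ _ "i mod int ?n"]) (auto simp: eq)
    ultimately show ?thesis using n by (auto simp: carrier_integer_mod_group)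
  qed
  ultimately have "integer_mod_group ?n \<cong> G"
    by (intro is_isoI) (simp add: iso_iff)
  then show ?thesis by (rule group.iso_sym[OF group_integer_mod_group])
qed

text \<open>\<open>g [^] (order G div d)\<close> has order \<open>d\<close>, and orders divide along
  inclusion of cyclic subgroups, so incomparable divisors give incomparable elements.\<close>

lemma cyclic_divisor_antichain:
  assumes "finite (carrier G)" and "g \<in> carrier G" and "generate G {g} = carrier G"
    and "\<forall>d\<in>D. d dvd order G" and "\<forall>d\<in>D. \<forall>e\<in>D. d dvd e \<longrightarrow> d = e"
  shows "\<exists>S. power_antichain G S \<and> card S = card D"
proof -
  let ?f = "\<lambda>d. g [^] (order G div d)"
  have ord_g: "ord g = order G" using assms(2,3) by (simp add: generate_pow_card order_def)
  have n: "order G > 0" using assms(1) by (simp add: order_gt_0_iff_finite)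
  have ord: "ord (?f d) = d" if d: "d \<in> D" for d
  proof -
    obtain k where k: "order G = d * k" using assms(4) d by blast
    moreover from this n have "order G div d = k" "k \<noteq> 0" "order G div k = d" by auto
    ultimately show ?thesis using ord_pow[OF assms(2), of k] ord_g by simp
  qed
  have "inj_on ?f D" using ord by (rule inj_on_inverseI)
  moreover have "power_antichain G (?f ` D)"
    unfolding power_antichain_def
  proof (intro conjI ballI impI)
    fix x y assume "x \<in> ?f ` D" "y \<in> ?f ` D" and gen: "x \<in> generate G {y}"
    then obtain d e where "d \<in> D" "e \<in> D" "x = ?f d" "y = ?f e" by blast
    moreover from this have "d dvd e"
      using ord_dvd_of_mem_generate[OF assms(1) _ gen] assms(2) ord by simp
    ultimately show "x = y" using assms(5) by blast
  qed (use assms(2) in auto)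
  ultimately show ?thesis by (metis card_image)
qed

end

section \<open>Groups covered by three cyclic subgroups\<close>

text \<open>The assumptions are symmetric in \<open>a\<close>, \<open>b\<close>, \<open>c\<close>,
  so every consequence holds in all six orderings, which \<open>swap\<close> and
  \<open>rotate\<close> generate. Below, A, B, C denote the subgroups generated by \<open>a\<close>,
  \<open>b\<close>, \<open>c\<close>.\<close>

locale three_cyclic_cover = group G for G (structure) +
  fixes a b c
  assumes fin: "finite (carrier G)"
    and gens: "a \<in> carrier G" "b \<in> carrier G" "c \<in> carrier G"
    and cover: "carrier G = generate G {a} \<union> generate G {b} \<union> generate G {c}"
    and indep: "a \<notin> generate G {b}" "a \<notin> generate G {c}" "b \<notin> generate G {a}"
      "b \<notin> generate G {c}" "c \<notin> generate G {a}" "c \<notin> generate G {b}"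
begin

lemma swap: "three_cyclic_cover G b a c"
  using fin gens cover indep by unfold_locales auto

lemma rotate: "three_cyclic_cover G b c a"
  using fin gens cover indep by unfold_locales auto

lemma subgroups: "subgroup (generate G {a}) G" "subgroup (generate G {b}) G"
    "subgroup (generate G {c}) G"
  using gens by (auto intro: generate_singleton_subgroup)

text \<open>The product is outside A because exactly one factor is in A, and likewise outside B; the
  cover leaves only C.\<close>

lemma mult_mem_third:
  assumes "x \<in> generate G {a}" "x \<notin> generate G {b}" "y \<in> generate G {b}" "y \<notin> generate G {a}"
  shows "x \<otimes> y \<in> generate G {c}"
proof -
  have xy: "x \<in> carrier G" "y \<in> carrier G" using assms(1,3) cover by auto
  then have "x \<otimes> y \<notin> generate G {a}" "x \<otimes> y \<notin> generate G {b}"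
    using assms subgroup_mult_mem_iff[OF subgroups(1)] subgroup_mult_mem_iff[OF subgroups(2)]
    by blast+
  then show ?thesis using m_closed[OF xy] cover by blast
qed

text \<open>Translate \<open>c\<close> by \<open>x\<close>: since \<open>x\<close> is in A and B but
  \<open>c\<close> in neither, \<open>x \<otimes> c\<close> is outside both, hence in C; cancel
  \<open>c\<close>.\<close>

lemma inter_subset_third:
  assumes "x \<in> generate G {a}" "x \<in> generate G {b}"
  shows "x \<in> generate G {c}"
proof -
  have x: "x \<in> carrier G" using assms(1) cover by auto
  then have "x \<otimes> c \<notin> generate G {a}" "x \<otimes> c \<notin> generate G {b}"
    using assms indep gens subgroup_mult_mem_iff(1)[OF subgroups(1)]
      subgroup_mult_mem_iff(1)[OF subgroups(2)] by blast+
  then have "x \<otimes> c \<in> generate G {c}" using m_closed[OF x gens(3)] cover by blast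
  then show ?thesis
    using subgroup_mult_mem_iff(2)[OF subgroups(3) generate_self x] by blast
qed

text \<open>Both \<open>a \<otimes> b\<close> and \<open>inv a \<otimes> b\<close> lie in C by
  \<open>mult_mem_third\<close>. Their quotient is \<open>a^2\<close>, which is then in A and C and
  hence in B.\<close>

lemma square_mem: "a [^] (2::nat) \<in> generate G {b}"
proof -
  interpret r: three_cyclic_cover G c a b
    using three_cyclic_cover.rotate[OF rotate] .
  have inv_a: "inv a \<in> generate G {a}" "inv a \<notin> generate G {b}"
    using subgroup.m_inv_closed[OF subgroups(1) generate_self] gens(1) indep(1)
      subgroup.m_inv_closed[OF subgroups(2), of "inv a"] by auto
  have "a \<otimes> b \<in> generate G {c}"
    using indep by (intro mult_mem_third) (auto intro: generate_self)
  moreover have ib: "inv a \<otimes> b \<in> generate G {c}"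
    using indep inv_a by (intro mult_mem_third) (auto intro: generate_self)
  moreover have "a \<otimes> b = a [^] (2::nat) \<otimes> (inv a \<otimes> b)"
  proof -
    have "a [^] (2::nat) \<otimes> (inv a \<otimes> b) = a \<otimes> (a \<otimes> inv a) \<otimes> b"
      using gens by (simp only: numeral_2_eq_2 nat_pow_Suc nat_pow_0 l_one m_assoc m_closed inv_closed)
    then show ?thesis using gens by simp
  qed
  ultimately have "a [^] (2::nat) \<in> generate G {c}"
    using subgroup_mult_mem_iff(2)[OF subgroups(3) ib, of "a [^] (2::nat)"] gens by simp
  moreover have "a [^] (2::nat) \<in> generate G {a}"
    using generate_pow_on_finite_carrier[OF fin gens(1)] by blast
  ultimately show ?thesis using r.inter_subset_third by blast
qed

text \<open>Even powers are powers of \<open>a^2\<close>, which is in B; an odd power is an even one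
  times \<open>a\<close>, which is not.\<close>

lemma pow_mem_iff: "a [^] (k::nat) \<in> generate G {b} \<longleftrightarrow> even k"
proof -
  have ev: "a [^] (2 * j) \<in> generate G {b}" for j :: nat
  proof -
    have "(a [^] (2::nat)) [^] j \<in> generate G {a [^] (2::nat)}"
      using generate_pow_on_finite_carrier[OF fin, of "a [^] (2::nat)"] gens(1) by blast
    then show ?thesis
      using generate_singleton_mono[OF gens(2) square_mem] gens(1) by (auto simp: nat_pow_pow)
  qed
  show ?thesis
  proof (cases "even k")
    case True
    then show ?thesis using ev by (auto elim: evenE)
  next
    case False
    then obtain j where "k = Suc (2 * j)" by (auto elim: oddE)
    then have "a [^] k = a [^] (2 * j) \<otimes> a" by simp
    then show ?thesis
      using False subgroup_mult_mem_iff(1)[OF subgroups(2) ev gens(1)] indep(1) by simp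
  qed
qed

lemma inter_eq: "generate G {a} \<inter> generate G {b} = generate G {a [^] (2::nat)}"
proof
  show "generate G {a} \<inter> generate G {b} \<subseteq> generate G {a [^] (2::nat)}"
  proof
    fix x assume x: "x \<in> generate G {a} \<inter> generate G {b}"
    then obtain k :: nat where k: "x = a [^] k"
      using generate_pow_on_finite_carrier[OF fin gens(1)] by auto
    then have "even k" using x pow_mem_iff by blast
    then obtain j where "k = 2 * j" by blast
    then have "x = (a [^] (2::nat)) [^] j" using k gens(1) by (simp add: nat_pow_pow)
    then show "x \<in> generate G {a [^] (2::nat)}"
      using generate_pow_on_finite_carrier[OF fin, of "a [^] (2::nat)"] gens(1) by blast
  qed
  have "a [^] (2::nat) \<in> generate G {a}"
    using generate_pow_on_finite_carrier[OF fin gens(1)] by blast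
  then show "generate G {a [^] (2::nat)} \<subseteq> generate G {a} \<inter> generate G {b}"
    using generate_singleton_mono gens square_mem by blast
qed

lemma generate_square_eq: "generate G {b [^] (2::nat)} = generate G {a [^] (2::nat)}"
  using inter_eq three_cyclic_cover.inter_eq[OF swap] by blast

text \<open>\<open>a [^] ord a = \<one>\<close> lies in B, so \<open>pow_mem_iff\<close> makes
  \<open>ord a\<close> even.\<close>

lemma ord_square: "ord a = 2 * ord (a [^] (2::nat))"
proof -
  have "\<one> \<in> generate G {b}" by (rule generate.one)
  then have "even (ord a)" using pow_mem_iff[of "ord a"] gens(1) by simp
  then show ?thesis using ord_pow[OF gens(1), of 2] by simp
qed

end

text \<open>
  If the order had an odd factor \<open>k > 1\<close>, the elements $a^k, b^k, c^k$ together with an element of order \<open>k\<close>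
  in the common intersection would be four pairwise incomparable elements.
\<close>

lemma (in three_cyclic_cover) ord_square_eq_power_of_2:
  assumes none: "\<not> (\<exists>S. power_antichain G S \<and> card S = 4)"
  obtains e :: nat where "ord (a [^] (2::nat)) = 2 ^ e"
proof -
  let ?m = "ord (a [^] (2::nat))"
  note ab = three_cyclic_cover_axioms
  note ba = swap
  note bc = rotate
  note cb = three_cyclic_cover.swap[OF bc]
  note ca = three_cyclic_cover.rotate[OF bc]
  note ac = three_cyclic_cover.swap[OF ca]
  have m: "?m > 0" using ord_ge_1[OF fin, of "a [^] (2::nat)"] gens(1) by simp
  obtain e k where mk: "?m = 2 ^ e * k" "odd k"
    using coprime_part_decompose[OF two_is_prime_nat m] by metis
  have ord_b: "ord b = 2 * ?m" and ord_c: "ord c = 2 * ?m"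
    using three_cyclic_cover.ord_square[OF ba] three_cyclic_cover.ord_square[OF ca]
      three_cyclic_cover.generate_square_eq[OF ab] three_cyclic_cover.generate_square_eq[OF ac]
      gens by (simp_all add: generate_pow_card)
  have ord_a: "ord a = 2 * ?m" by (rule ord_square)
  \<comment> \<open>Dividing out the 2-part of \<open>?m\<close> leaves an element of order exactly
    \<open>k\<close> in the common intersection.\<close>
  define z where "z = (a [^] (2::nat)) [^] (2 ^ e :: nat)"
  have z: "z \<in> carrier G" using gens(1) by (simp add: z_def)
  have ord_z: "ord z = k"
    unfolding z_def using gens(1) mk m by (subst ord_pow) auto
  have z_sub: "generate G {z} \<subseteq> generate G {a} \<inter> generate G {b} \<inter> generate G {c}"
  proof -
    have "z \<in> generate G {a [^] (2::nat)}"
      unfolding z_def using generate_pow_on_finite_carrier[OF fin, of "a [^] (2::nat)"] gens(1)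
      by blast
    then have "generate G {z} \<subseteq> generate G {a} \<inter> generate G {b}"
      unfolding inter_eq using generate_singleton_mono gens(1) by blast
    then show ?thesis using inter_subset_third by blast
  qed
  then have z_a: "generate G {z} \<subseteq> generate G {a}" and z_b: "generate G {z} \<subseteq> generate G {b}"
    and z_c: "generate G {z} \<subseteq> generate G {c}"
    by auto
  have pow: "generate G {x [^] k} \<subseteq> generate G {x}" if "x \<in> carrier G" for x
    using that generate_pow_on_finite_carrier[OF fin that] by (intro generate_singleton_mono) blast+
  \<comment> \<open>Since \<open>k\<close> is odd, \<open>x [^] k\<close> stays outside the subgroup
    of \<open>y\<close>, hence outside those of \<open>y [^] k\<close> and \<open>z\<close> inside
    it.\<close>
  have notin: "x [^] k \<notin> generate G {y [^] k}" "x [^] k \<notin> generate G {z}"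
    if "three_cyclic_cover G x y w" "generate G {z} \<subseteq> generate G {y}" for x y w
    using three_cyclic_cover.pow_mem_iff[OF that(1), of k] mk(2) that(2)
      pow[OF three_cyclic_cover.gens(2)[OF that(1)]] by blast+
  have "k = 1"
  proof (rule ccontr)
    assume "k \<noteq> 1"
    \<comment> \<open>\<open>x [^] k\<close> has 2-power order, which the odd number
      \<open>k > 1\<close> does not divide.\<close>
    have z_notin: "z \<notin> generate G {x [^] k}" if x: "x \<in> carrier G" "ord x = 2 * ?m" for x
    proof
      assume "z \<in> generate G {x [^] k}"
      then have "k dvd ord (x [^] k)"
        using ord_dvd_of_mem_generate[OF fin, of "x [^] k" z] x(1) ord_z by simp
      moreover have "ord (x [^] k) = 2 ^ Suc e"
        using ord_pow[OF x(1), of k] x(2) mk m by auto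
      ultimately have "k dvd 2 ^ Suc e" by simp
      then show False
        using mk(2) \<open>k \<noteq> 1\<close> by (auto simp: divides_primepow_nat simp del: power_Suc)
    qed
    have n: "a [^] k \<notin> generate G {b [^] k}" "a [^] k \<notin> generate G {c [^] k}"
      "b [^] k \<notin> generate G {a [^] k}" "b [^] k \<notin> generate G {c [^] k}"
      "c [^] k \<notin> generate G {a [^] k}" "c [^] k \<notin> generate G {b [^] k}"
      "a [^] k \<notin> generate G {z}" "b [^] k \<notin> generate G {z}" "c [^] k \<notin> generate G {z}"
      "z \<notin> generate G {a [^] k}" "z \<notin> generate G {b [^] k}" "z \<notin> generate G {c [^] k}"
      using notin[OF ab z_b] notin[OF ac z_c] notin[OF ba z_a] notin[OF bc z_c] notin[OF ca z_a]
        notin[OF cb z_b] z_notin[OF gens(1) ord_a] z_notin[OF gens(2) ord_b]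
        z_notin[OF gens(3) ord_c] by simp_all
    let ?S = "{a [^] k, b [^] k, c [^] k, z}"
    have "power_antichain G ?S"
      unfolding power_antichain_def using n gens z by auto
    moreover have "card ?S = 4"
    proof -
      have "a [^] k \<noteq> b [^] k" "a [^] k \<noteq> c [^] k" "a [^] k \<noteq> z" "b [^] k \<noteq> c [^] k"
        "b [^] k \<noteq> z" "c [^] k \<noteq> z"
        using n generate_self by metis+
      then show ?thesis by simp
    qed
    ultimately show False using none by blast
  qed
  then show thesis using that mk(1) by simp
qed

section \<open>Noncyclic groups without large antichains\<close>

text \<open>Choose \<open>y\<close> of largest order among the elements whose subgroup contains
  \<open>x\<close>. A cyclic subgroup around that of \<open>y\<close> also contains
  \<open>x\<close>, so it cannot be larger.\<close>

lemma (in group) ex_maximal_cyclic: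
  assumes "finite (carrier G)" and "x \<in> carrier G"
  obtains y where "y \<in> carrier G" and "x \<in> generate G {y}"
    and "\<And>z. z \<in> carrier G \<Longrightarrow> y \<in> generate G {z} \<Longrightarrow> z \<in> generate G {y}"
proof -
  let ?P = "\<lambda>y. y \<in> carrier G \<and> x \<in> generate G {y}"
  have "?P x" using assms(2) generate_self by simp
  moreover have "\<forall>y. ?P y \<longrightarrow> ord y < Suc (order G)"
    using ord_le_group_order[OF assms(1)] by (simp add: less_Suc_eq_le)
  ultimately have "\<exists>y. ?P y \<and> (\<forall>z. ?P z \<longrightarrow> ord z \<le> ord y)"
    by (rule ex_has_greatest_nat)
  then obtain y where y: "?P y" and le: "\<And>z. ?P z \<Longrightarrow> ord z \<le> ord y" by blast
  have "z \<in> generate G {y}" if z: "z \<in> carrier G" "y \<in> generate G {z}" for z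
  proof -
    have sub: "generate G {y} \<subseteq> generate G {z}" using generate_singleton_mono[OF z] .
    have "finite (generate G {z})"
      using assms(1) generate_incl[of "{z}"] z(1) finite_subset by simp
    moreover have "card (generate G {z}) \<le> card (generate G {y})"
      using le[of z] subsetD[OF sub] y z(1) by (simp add: generate_pow_card)
    ultimately have "generate G {y} = generate G {z}" using sub by (intro card_seteq)
    then show ?thesis using generate_self by blast
  qed
  then show thesis using that y by blast
qed

text \<open>Generators of distinct maximal cyclic subgroups are incomparable, so an element outside
  three of them would lead to an antichain of size 4.\<close>

lemma (in group) noncyclic_three_cyclic_cover:
  assumes fin: "finite (carrier G)"
    and none: "\<not> (\<exists>S. power_antichain G S \<and> card S = 4)"
    and noncyclic: "\<And>g. g \<in> carrier G \<Longrightarrow> generate G {g} \<noteq> carrier G"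
  obtains a b c where "three_cyclic_cover G a b c"
proof -
  have sub: "generate G {g} \<subseteq> carrier G" if "g \<in> carrier G" for g
    using generate_incl[of "{g}"] that by simp
  obtain a where a: "a \<in> carrier G"
    and max_a: "\<And>z. z \<in> carrier G \<Longrightarrow> a \<in> generate G {z} \<Longrightarrow> z \<in> generate G {a}"
    using ex_maximal_cyclic[OF fin one_closed] by blast
  obtain x where x: "x \<in> carrier G" "x \<notin> generate G {a}"
    using sub[OF a] noncyclic[OF a] by blast
  obtain b where b: "b \<in> carrier G" and xb: "x \<in> generate G {b}"
    and max_b: "\<And>z. z \<in> carrier G \<Longrightarrow> b \<in> generate G {z} \<Longrightarrow> z \<in> generate G {b}"
    using ex_maximal_cyclic[OF fin x(1)] by blast
  have ba: "b \<notin> generate G {a}" using x(2) xb generate_singleton_mono[OF a] by blast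
  then have ab: "a \<notin> generate G {b}" using max_a[OF b] by blast
  obtain c where c: "c \<in> carrier G" and abc: "a \<otimes> b \<in> generate G {c}"
    and max_c: "\<And>z. z \<in> carrier G \<Longrightarrow> c \<in> generate G {z} \<Longrightarrow> z \<in> generate G {c}"
    using ex_maximal_cyclic[OF fin m_closed[OF a b]] by blast
  \<comment> \<open>The product escapes the first subgroup because \<open>b\<close> does and the
    second because \<open>a\<close> does, so \<open>c\<close> gives a third one.\<close>
  have "a \<otimes> b \<notin> generate G {a}"
    using subgroup_mult_mem_iff(1)[OF generate_singleton_subgroup[OF a] generate_self b] ba by blast
  then have ca: "c \<notin> generate G {a}" using abc generate_singleton_mono[OF a] by blast
  have "a \<otimes> b \<notin> generate G {b}"
    using subgroup_mult_mem_iff(2)[OF generate_singleton_subgroup[OF b] generate_self a] ab by blast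
  then have cb: "c \<notin> generate G {b}" using abc generate_singleton_mono[OF b] by blast
  have ac: "a \<notin> generate G {c}" and bc: "b \<notin> generate G {c}"
    using max_a[OF c] max_b[OF c] ca cb by blast+
  have "y \<in> generate G {a} \<union> generate G {b} \<union> generate G {c}" if y: "y \<in> carrier G" for y
  proof (rule ccontr)
    assume not: "y \<notin> generate G {a} \<union> generate G {b} \<union> generate G {c}"
    obtain d where d: "d \<in> carrier G" and yd: "y \<in> generate G {d}"
      using ex_maximal_cyclic[OF fin y] by blast
    have n1: "d \<notin> generate G {a}" "d \<notin> generate G {b}" "d \<notin> generate G {c}"
      using not yd generate_singleton_mono[OF a] generate_singleton_mono[OF b]
        generate_singleton_mono[OF c] by blast+
    then have n2: "a \<notin> generate G {d}" "b \<notin> generate G {d}" "c \<notin> generate G {d}"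
      using max_a[OF d] max_b[OF d] max_c[OF d] by blast+
    have "power_antichain G {a, b, c, d}"
      unfolding power_antichain_def using a b c d ab ba ac ca bc cb n1 n2 by auto
    moreover have "card {a, b, c, d} = 4"
    proof -
      have "a \<noteq> b" "a \<noteq> c" "a \<noteq> d" "b \<noteq> c" "b \<noteq> d" "c \<noteq> d"
        using ba ca cb n1 generate_self by metis+
      then show ?thesis by simp
    qed
    ultimately show False using none by blast
  qed
  then have "carrier G = generate G {a} \<union> generate G {b} \<union> generate G {c}"
    using sub a b c by blast
  then have "three_cyclic_cover G a b c"
    using fin a b c ab ba ac ca bc cb by unfold_locales auto
  then show thesis by (rule that)
qed

section \<open>Recognising the Klein four-group and \<open>Q8\<close> by relations\<close>

lemma (in group) iso_klein_four:
  assumes ab: "a \<in> carrier G" "b \<in> carrier G"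
    and rel: "a \<otimes> a = \<one>" "b \<otimes> b = \<one>" "b \<otimes> a = a \<otimes> b"
    and ne: "a \<noteq> \<one>" "b \<noteq> \<one>" "a \<noteq> b"
    and carrier: "carrier G = {\<one>, a, b, a \<otimes> b}"
  shows "G \<cong> integer_mod_group 2 \<times>\<times> integer_mod_group 2"
proof -
  let ?K = "integer_mod_group 2 \<times>\<times> integer_mod_group 2"
  define h where "h = (\<lambda>(i, j). (if i = (0::int) then \<one> else a) \<otimes> (if j = (0::int) then \<one> else b))"
  have K: "carrier ?K = {(0, 0), (1, 0), (0, 1), (1, 1)}"
    by (auto simp: carrier_integer_mod_group)
  \<comment> \<open>The relations with an arbitrary tail \<open>x\<close> let rewriting bring every
    word to the form \<open>a^i b^j\<close>.\<close>
  have rel': "a \<otimes> (a \<otimes> x) = x" "b \<otimes> (b \<otimes> x) = x" "b \<otimes> (a \<otimes> x) = a \<otimes> (b \<otimes> x)"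
    if "x \<in> carrier G" for x
    using that ab rel by (simp_all flip: m_assoc)
  have "a \<otimes> b \<noteq> \<one>" using rel'(1)[OF ab(2)] ab ne(3) by auto
  moreover have "a \<otimes> b \<noteq> a" "a \<otimes> b \<noteq> b" using ab ne by simp_all
  ultimately have ne': "a \<noteq> \<one>" "b \<noteq> \<one>" "a \<noteq> b" "a \<otimes> b \<noteq> \<one>" "a \<otimes> b \<noteq> a" "a \<otimes> b \<noteq> b"
    using ne by auto
  have "inj_on h (carrier ?K)"
    unfolding K using ab by (simp add: inj_on_def h_def ne' ne'[symmetric])
  moreover have "h ` carrier ?K = carrier G"
    unfolding K carrier using ab by (simp add: h_def)
  moreover have "h \<in> hom ?K G"
    unfolding hom_def K using ab rel rel' by (simp add: h_def m_assoc)
  ultimately have "?K \<cong> G" by (intro is_isoI) (simp add: iso_iff)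
  then show ?thesis 
    by (rule group.iso_sym[OF DirProd_group[OF group_integer_mod_group group_integer_mod_group]])
qed

text \<open>\<open>z\<close>, \<open>a\<close>, \<open>b\<close>, \<open>a \<otimes> b\<close> play
  the parts of -1, i, j, k; the relations say that i^2 = j^2 = -1 and ji = -ij.\<close>

lemma (in group) iso_Q8:
  assumes ab: "a \<in> carrier G" "b \<in> carrier G" and z: "z = a \<otimes> a"
    and rel: "b \<otimes> b = z" "z \<otimes> z = \<one>" "b \<otimes> a = z \<otimes> (a \<otimes> b)"
    and ne: "z \<noteq> \<one>" "b \<noteq> a" "b \<noteq> z \<otimes> a"
    and carrier: "carrier G =
      {\<one>, z, a, z \<otimes> a, b, z \<otimes> b, a \<otimes> b, z \<otimes> (a \<otimes> b)}"
  shows "G \<cong> Q8"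
proof -
  define h where "h = (\<lambda>(w, x, y, v).
      if w = (1::int) then \<one> else if w = -1 then z else
      if x = (1::int) then a else if x = -1 then z \<otimes> a else
      if y = (1::int) then b else if y = -1 then z \<otimes> b else
      if v = (1::int) then a \<otimes> b else z \<otimes> (a \<otimes> b))"
  have zc: "z \<in> carrier G" using ab z by simp
  have comm: "a \<otimes> z = z \<otimes> a" "b \<otimes> z = z \<otimes> b"
    using ab by (simp add: z m_assoc, simp add: m_assoc flip: rel(1))
  \<comment> \<open>With these rules every product reduces to an optional \<open>z\<close>, then an
    optional \<open>a\<close> and an optional \<open>b\<close>, so the homomorphism law becomes a
    check over all pairs in \<open>Q8\<close>.\<close>
  have rel': "z \<otimes> (z \<otimes> x) = x" "a \<otimes> (a \<otimes> x) = z \<otimes> x" "b \<otimes> (b \<otimes> x) = z \<otimes> x"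
    "a \<otimes> (z \<otimes> x) = z \<otimes> (a \<otimes> x)" "b \<otimes> (z \<otimes> x) = z \<otimes> (b \<otimes> x)"
    "b \<otimes> (a \<otimes> x) = z \<otimes> (a \<otimes> (b \<otimes> x))" if x: "x \<in> carrier G" for x
  proof -
    show "z \<otimes> (z \<otimes> x) = x" using x zc rel(2) by (simp flip: m_assoc)
    show "a \<otimes> (a \<otimes> x) = z \<otimes> x" using x ab z by (simp add: m_assoc)
    show "b \<otimes> (b \<otimes> x) = z \<otimes> x" using x ab rel(1) by (simp flip: m_assoc)
    show "a \<otimes> (z \<otimes> x) = z \<otimes> (a \<otimes> x)" "b \<otimes> (z \<otimes> x) = z \<otimes> (b \<otimes> x)"
      using x ab zc comm by (simp_all flip: m_assoc)
    show "b \<otimes> (a \<otimes> x) = z \<otimes> (a \<otimes> (b \<otimes> x))"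
      using x ab zc rel(3) by (simp flip: m_assoc)
  qed
  note simps = rel comm rel' z[symmetric] m_assoc
  have hom: "h \<in> hom Q8 G"
  proof -
    have "\<forall>p\<in>carrier Q8. h p \<in> carrier G" using ab zc by (simp add: Q8_def h_def)
    moreover have "\<forall>p\<in>carrier Q8. \<forall>q\<in>carrier Q8. h (p \<otimes>\<^bsub>Q8\<^esub> q) = h p \<otimes> h q"
      using ab zc by (simp add: Q8_def h_def simps)
    ultimately show ?thesis by (auto simp: hom_def)
  qed
  interpret h: group_hom Q8 G h
    using hom by (simp add: group_hom_def group_hom_axioms_def group_Q8 is_group)
  \<comment> \<open>Together with \<open>z\<close> these are the images of the seven nonidentity
    elements, so the kernel is trivial. The inequalities for \<open>b\<close> keep
    \<open>a \<otimes> b\<close> and \<open>z \<otimes> (a \<otimes> b)\<close> away from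
    \<open>\<one>\<close>.\<close>
  have a1: "a \<noteq> \<one>" "z \<otimes> a \<noteq> \<one>" "b \<noteq> \<one>" "z \<otimes> b \<noteq> \<one>"
    "a \<otimes> b \<noteq> \<one>" "z \<otimes> (a \<otimes> b) \<noteq> \<one>"
  proof -
    have "b = z \<otimes> a" if "a \<otimes> b = \<one>"
    proof -
      have "z \<otimes> b = a" using that rel'(2)[OF ab(2)] ab by simp
      then show ?thesis using rel'(1)[OF ab(2)] by simp
    qed
    then show "a \<otimes> b \<noteq> \<one>" using ne by blast
    have "b = a" if "z \<otimes> (a \<otimes> b) = \<one>"
    proof -
      have "a \<otimes> b = z" using that rel'(1)[of "a \<otimes> b"] ab zc by simp
      then show ?thesis using z ab by simp
    qed
    then show "z \<otimes> (a \<otimes> b) \<noteq> \<one>" using ne by blast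
    show "a \<noteq> \<one>" "b \<noteq> \<one>" using ne(1) z rel(1) by auto
    have "x = z" if "z \<otimes> x = \<one>" "x \<in> carrier G" for x
      using that rel'(1)[OF that(2)] zc by simp
    then show "z \<otimes> a \<noteq> \<one>" "z \<otimes> b \<noteq> \<one>" using ab ne(1) z rel(1,2) by force+
  qed
  have "kernel Q8 G h = {\<one>\<^bsub>Q8\<^esub>}"
    unfolding kernel_def using a1 ne(1) by (auto simp: Q8_def h_def)
  then have "inj_on h (carrier Q8)" using h.inj_iff_trivial_ker by blast
  moreover have "h ` carrier Q8 = carrier G"
    unfolding carrier using ab zc by (auto simp: Q8_def h_def)
  ultimately have "Q8 \<cong> G" using hom by (intro is_isoI[of h]) (simp add: iso_iff)
  then show ?thesis by (rule group.iso_sym[OF group_Q8])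
qed

section \<open>Identifying the group\<close>

context three_cyclic_cover
begin

text \<open>With N the subgroup generated by \<open>a^2\<close>, A is the union of N and its coset
  of \<open>a\<close>: split the exponent by parity.\<close>

lemma mem_a_cases:
  assumes "x \<in> generate G {a}"
  obtains n where "n \<in> generate G {a [^] (2::nat)}" and "x = n \<or> x = n \<otimes> a"
proof -
  obtain k :: nat where k: "x = a [^] k"
    using assms generate_pow_on_finite_carrier[OF fin gens(1)] by auto
  have "a [^] (2 * (k div 2)) = (a [^] (2::nat)) [^] (k div 2)"
    using gens(1) by (simp add: nat_pow_pow)
  then have "a [^] (2 * (k div 2)) \<in> generate G {a [^] (2::nat)}"
    using generate_pow_on_finite_carrier[OF fin, of "a [^] (2::nat)"] gens(1) by auto
  moreover have "k = 2 * (k div 2) \<or> k = Suc (2 * (k div 2))" by presburger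
  then have "x = a [^] (2 * (k div 2)) \<or> x = a [^] (2 * (k div 2)) \<otimes> a"
    using k by (metis nat_pow_Suc)
  ultimately show thesis by (rule that)
qed

text \<open>The cosets of N are those of \<open>\<one>\<close>, \<open>a\<close>, \<open>b\<close>,
  \<open>a \<otimes> b\<close>: A and B fall under \<open>mem_a_cases\<close>, and multiplication by
  \<open>inv b\<close> moves the rest of C into A.\<close>

lemma carrier_cases:
  assumes x: "x \<in> carrier G"
  obtains n where "n \<in> generate G {a [^] (2::nat)}"
    and "x = n \<or> x = n \<otimes> a \<or> x = n \<otimes> b \<or> x = n \<otimes> (a \<otimes> b)"
proof -
  interpret ba: three_cyclic_cover G b a c by (rule swap)
  interpret bc: three_cyclic_cover G b c a by (rule rotate)
  interpret cb: three_cyclic_cover G c b a by (rule bc.swap)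
  consider "x \<in> generate G {a}" | "x \<in> generate G {b}"
    | "x \<in> generate G {c}" "x \<notin> generate G {b}"
    using x cover by blast
  then show thesis
  proof cases
    case 1
    then show thesis using mem_a_cases that by metis
  next
    case 2
    then show thesis using ba.mem_a_cases[OF 2] that unfolding generate_square_eq by metis
  next
    case 3
    have ib: "inv b \<in> generate G {b}" "inv b \<notin> generate G {c}"
      using subgroup.m_inv_closed[OF subgroups(2) generate_self] gens(2) indep(4)
        subgroup.m_inv_closed[OF subgroups(3), of "inv b"] by auto
    obtain n where n: "n \<in> generate G {a [^] (2::nat)}"
      and xn: "x \<otimes> inv b = n \<or> x \<otimes> inv b = n \<otimes> a"
      using mem_a_cases[OF cb.mult_mem_third[OF 3 ib]] by blast
    have "n \<in> carrier G"
      using n generate_incl[of "{a [^] (2::nat)}"] gens(1) by auto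
    moreover have "x = (x \<otimes> inv b) \<otimes> b" using x gens(2) by (simp add: m_assoc)
    ultimately have "x = n \<otimes> b \<or> x = n \<otimes> (a \<otimes> b)"
      using xn gens by (metis m_assoc)
    then show thesis using that n by blast
  qed
qed

text \<open>
  Both \<open>b\<^sup>2\<close> and \<open>(ab)\<^sup>2\<close> generate the group of \<open>u = a\<^sup>2\<close>. If its order \<open>2\<^sup>e\<close> is even, then
  writing \<open>ba = u\<^sup>t ab\<close> and \<open>b\<^sup>2 = u\<^sup>j\<close> gives \<open>(ab)\<^sup>2 = u\<^bsup>t+1+j\<^esup>\<close>, so that \<open>t\<close> is odd, while
  \<open>ba\<^sup>2 = a\<^sup>2b\<close> gives \<open>u\<^bsup>2t\<^esup> = 1\<close>.
\<close>

lemma square_relations: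
  assumes none: "\<not> (\<exists>S. power_antichain G S \<and> card S = 4)"
  obtains
    (klein) "a [^] (2::nat) = \<one>"
  | (quaternion) "ord (a [^] (2::nat)) = 2" "b [^] (2::nat) = a [^] (2::nat)"
      "b \<otimes> a = a [^] (2::nat) \<otimes> (a \<otimes> b)"
proof -
  define u where "u = a [^] (2::nat)"
  have u: "u \<in> carrier G" using gens(1) by (simp add: u_def)
  have N: "generate G {u} = {u [^] k |k. k \<in> (UNIV :: nat set)}"
    by (rule generate_pow_on_finite_carrier[OF fin u])
  obtain e where e: "ord u = 2 ^ e"
    using ord_square_eq_power_of_2[OF none] unfolding u_def by blast
  show thesis
  proof (cases "e = 0")
    case True
    then show thesis using klein e u ord_eq_1 by (simp add: u_def)
  next
    case False
    then have even_m: "even (ord u)" using e by simp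
    interpret ba: three_cyclic_cover G b a c by (rule swap)
    interpret bc: three_cyclic_cover G b c a by (rule rotate)
    interpret ca: three_cyclic_cover G c a b by (rule bc.rotate)
    \<comment> \<open>A power of \<open>u\<close> of full order has exponent coprime to the even
      number \<open>ord u\<close>.\<close>
    have odd_exp: "odd k" if "ord (u [^] k) = ord u" for k :: nat
      using that even_m pow_ord_eq_ord_iff[OF fin u, of k] by (metis coprime_common_divisor odd_one)
    obtain j :: nat where j: "b [^] (2::nat) = u [^] j"
      using generate_self[of "b [^] (2::nat)"] generate_square_eq N unfolding u_def by auto
    have "ord (b [^] (2::nat)) = ord u"
      using generate_square_eq gens unfolding u_def by (simp add: generate_pow_card)
    then have "ord (u [^] j) = ord u" unfolding j .
    then have odd_j: "odd j" by (rule odd_exp)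
    have ub: "b \<otimes> u = u \<otimes> b"
    proof -
      obtain k :: nat where "u = (b [^] (2::nat)) [^] k"
        using generate_self[of u] generate_square_eq gens(2)
          generate_pow_on_finite_carrier[OF fin, of "b [^] (2::nat)"] unfolding u_def by auto
      then have "u = b [^] (2 * k)" using gens(2) by (simp add: nat_pow_pow)
      then show ?thesis using nat_pow_Suc2[OF gens(2), of "2 * k"] by simp
    qed
    have ua: "a \<otimes> u = u \<otimes> a"
      unfolding u_def using nat_pow_Suc2[OF gens(1), of 2] unfolding nat_pow_Suc by simp
    have ab_c: "a \<otimes> b \<in> generate G {c}"
      by (rule mult_mem_third[OF generate_self indep(1) generate_self indep(3)])
    have not_a: "a \<otimes> b \<notin> generate G {a}" "b \<otimes> a \<notin> generate G {a}"
      using subgroup_mult_mem_iff[OF subgroups(1) generate_self gens(2)] indep(3) by auto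
    have not_b: "b \<otimes> a \<notin> generate G {b}"
      using subgroup_mult_mem_iff[OF subgroups(2) generate_self gens(1)] indep(1) by auto
    have N_sub: "generate G {u} \<subseteq> generate G {a}" "generate G {u} \<subseteq> generate G {b}"
      using inter_eq unfolding u_def by auto
    \<comment> \<open>Only the coset of \<open>a \<otimes> b\<close> remains: the other three lie in
      A or B, and \<open>b \<otimes> a\<close> is in neither.\<close>
    obtain n where n: "n \<in> generate G {u}" and
      ban: "b \<otimes> a = n \<or> b \<otimes> a = n \<otimes> a \<or> b \<otimes> a = n \<otimes> b \<or> b \<otimes> a = n \<otimes> (a \<otimes> b)"
      using carrier_cases[OF m_closed[OF gens(2,1)]] unfolding u_def by blast
    have "n \<otimes> a \<in> generate G {a}" "n \<otimes> b \<in> generate G {b}"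
      using subgroup_mult_mem_iff(1)[OF subgroups(1) _ gens(1)] n N_sub generate_self
        subgroup_mult_mem_iff(1)[OF subgroups(2) _ gens(2)] by blast+
    then have "b \<otimes> a = n \<otimes> (a \<otimes> b)"
      using ban not_a not_b n N_sub by auto
    then obtain t :: nat where t: "b \<otimes> a = u [^] t \<otimes> (a \<otimes> b)"
      using n N by auto
    have comm: "a \<otimes> u [^] t = u [^] t \<otimes> a" "b \<otimes> u [^] t = u [^] t \<otimes> b"
      using group_commutes_pow[OF ua[symmetric] u gens(1)]
        group_commutes_pow[OF ub[symmetric] u gens(2)] by simp_all
    note cl = gens(1,2) u nat_pow_closed[OF u]
    have aa: "a \<otimes> a = u" unfolding u_def using gens(1) by (simp add: numeral_2_eq_2)
    have bb: "b \<otimes> b = u [^] j" unfolding j[symmetric] using gens(2) by (simp add: numeral_2_eq_2)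
    \<comment> \<open>Move \<open>b\<close> past the two factors of
      \<open>b \<otimes> a \<otimes> a\<close> one at a time, each time collecting
      \<open>u [^] t\<close>.\<close>
    have "u [^] (2 * t) \<otimes> (u \<otimes> b) = u \<otimes> b"
    proof -
      have "u \<otimes> b = b \<otimes> a \<otimes> a" using ub cl by (simp add: m_assoc flip: aa)
      also have "\<dots> = u [^] t \<otimes> (a \<otimes> b) \<otimes> a" by (simp only: t)
      also have "\<dots> = u [^] t \<otimes> a \<otimes> (b \<otimes> a)" using cl by (simp add: m_assoc)
      also have "\<dots> = u [^] t \<otimes> (a \<otimes> u [^] t) \<otimes> a \<otimes> b"
        unfolding t using cl by (simp add: m_assoc)
      also have "\<dots> = (u [^] t \<otimes> u [^] t) \<otimes> (a \<otimes> a \<otimes> b)"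
        unfolding comm using cl by (simp add: m_assoc)
      also have "\<dots> = u [^] (2 * t) \<otimes> (u \<otimes> b)"
        using cl by (simp add: nat_pow_mult aa mult_2)
      finally show ?thesis by simp
    qed
    then have "u [^] (2 * t) = \<one>" using cl by (simp add: r_cancel_one)
    then have dvd: "2 ^ e dvd 2 * t" using pow_eq_id[OF u] e by simp
    have "(a \<otimes> b) [^] (2::nat) = u [^] (t + 1 + j)"
    proof -
      have "(a \<otimes> b) [^] (2::nat) = a \<otimes> (b \<otimes> a) \<otimes> b"
        using cl by (simp add: numeral_2_eq_2 m_assoc)
      also have "\<dots> = (a \<otimes> u [^] t) \<otimes> a \<otimes> (b \<otimes> b)"
        unfolding t using cl by (simp add: m_assoc)
      also have "\<dots> = u [^] t \<otimes> (a \<otimes> a) \<otimes> u [^] j"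
        unfolding comm bb using cl by (simp add: m_assoc)
      also have "\<dots> = u [^] t \<otimes> u [^] (1::nat) \<otimes> u [^] j"
        using cl by (simp add: aa)
      finally show ?thesis using cl by (simp only: nat_pow_mult)
    qed
    \<comment> \<open>\<open>a \<otimes> b\<close> is a power of \<open>c\<close> outside A, so an
      odd one, and its square is an odd power of \<open>c^2\<close>. As \<open>c^2\<close> has the
      same 2-power order as \<open>u\<close>, odd exponents keep the order.\<close>
    moreover have "ord ((a \<otimes> b) [^] (2::nat)) = ord u"
    proof -
      obtain k :: nat where k: "a \<otimes> b = c [^] k"
        using ab_c generate_pow_on_finite_carrier[OF fin gens(3)] by auto
      then have "odd k" using not_a ca.pow_mem_iff by metis
      have sq: "generate G {c [^] (2::nat)} = generate G {u}"
        unfolding u_def using ca.generate_square_eq by simp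
      have c2: "c [^] (2::nat) \<in> carrier G" using gens(3) by simp
      have ord_c2: "ord (c [^] (2::nat)) = ord u"
        using sq u c2 by (simp add: generate_pow_card)
      have "coprime k (ord (c [^] (2::nat)))"
        unfolding ord_c2 e using \<open>odd k\<close> by simp
      then have "ord ((c [^] (2::nat)) [^] k) = ord (c [^] (2::nat))"
        using pow_ord_eq_ord_iff[OF fin c2] by blast
      moreover have "(a \<otimes> b) [^] (2::nat) = (c [^] (2::nat)) [^] k"
        unfolding k using gens(3) by (simp add: nat_pow_pow mult.commute)
      ultimately show ?thesis using ord_c2 by simp
    qed
    ultimately have "odd (t + 1 + j)" using odd_exp by metis
    then have odd_t: "odd t" using odd_j by simp
    then have "2 ^ e dvd (2::nat) ^ 1"
      using dvd by (simp add: coprime_dvd_mult_left_iff)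
    then have "e \<le> 1" by (rule power_dvd_imp_le) simp
    then have ord_u: "ord u = 2" using e False by (simp add: le_Suc_eq)
    \<comment> \<open>\<open>u\<close> is now an involution, so \<open>u [^] j\<close> and
      \<open>u [^] t\<close> are both \<open>u\<close>, which yields the relations of
      \<open>Q8\<close>.\<close>
    have odd_pow: "u [^] k = u" if k: "odd k" for k :: nat
    proof -
      obtain i where "k = 2 * i + 1" using k by (rule oddE)
      then show ?thesis
        using u pow_ord_eq_1[OF u] unfolding ord_u by (simp flip: nat_pow_pow)
    qed
    show thesis
      using quaternion ord_u j t odd_pow[OF odd_j] odd_pow[OF odd_t] by (simp add: u_def)
  qed
qed

text \<open>In either case of \<open>square_relations\<close> N is known explicitly, and
  \<open>carrier_cases\<close> then lists the whole group.\<close>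

lemma iso_klein_four_or_Q8:
  assumes none: "\<not> (\<exists>S. power_antichain G S \<and> card S = 4)"
  shows "G \<cong> Q8 \<or> G \<cong> integer_mod_group 2 \<times>\<times> integer_mod_group 2"
  using none
proof (cases rule: square_relations)
  case klein
  have N: "generate G {a [^] (2::nat)} = {\<one>}"
    using klein generate_one by simp
  have sq: "a \<otimes> a = \<one>" "b \<otimes> b = \<one>"
    using klein generate_square_eq generate_self[of "b [^] (2::nat)"] gens
    unfolding N by (simp_all add: numeral_2_eq_2)
  have cases: "x \<in> {\<one>, a, b, a \<otimes> b}" if "x \<in> carrier G" for x
    using carrier_cases[OF that] gens unfolding N by auto
  have ne: "a \<noteq> \<one>" "b \<noteq> \<one>" "a \<noteq> b"
    using indep generate_self generate.one[of G] by metis+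
  have "b \<otimes> a \<noteq> \<one>"
  proof
    assume "b \<otimes> a = \<one>"
    then have "b \<otimes> (b \<otimes> a) = b" using gens by simp
    then show False using sq gens ne(3) by (simp flip: m_assoc)
  qed
  then have "b \<otimes> a = a \<otimes> b"
    using cases[of "b \<otimes> a"] gens ne sq by auto
  moreover have "carrier G = {\<one>, a, b, a \<otimes> b}"
    using cases gens by auto
  ultimately show ?thesis using iso_klein_four[OF gens(1,2) sq _ ne] by blast
next
  case quaternion
  define z where "z = a \<otimes> a"
  have z: "a [^] (2::nat) = z" "z \<in> carrier G"
    unfolding z_def using gens(1) by (simp_all add: numeral_2_eq_2)
  have zz: "z \<otimes> z = \<one>"
  proof -
    have "ord z = 2" using quaternion(1) unfolding z(1) .
    then have "z [^] (2::nat) = \<one>" using pow_ord_eq_1[OF z(2)] by simp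
    then show ?thesis using z(2) by (simp add: numeral_2_eq_2)
  qed
  have z1: "z \<noteq> \<one>" using quaternion(1) z(1) by auto
  have N: "generate G {a [^] (2::nat)} = {\<one>, z}"
  proof -
    have "card {\<one>, z} = card (generate G {z})"
      using z1 quaternion(1) z by (simp add: generate_pow_card)
    moreover have "{\<one>, z} \<subseteq> generate G {z}"
      using generate_self generate.one[of G] by auto
    moreover have "finite (generate G {z})"
      using fin generate_incl[of "{z}"] z(2) finite_subset by auto
    ultimately show ?thesis unfolding z(1) using card_subset_eq by metis
  qed
  have "x \<in> {\<one>, z, a, z \<otimes> a, b, z \<otimes> b, a \<otimes> b, z \<otimes> (a \<otimes> b)}"
    if x: "x \<in> carrier G" for x
  proof -
    obtain n where "n \<in> {\<one>, z}"
      and "x = n \<or> x = n \<otimes> a \<or> x = n \<otimes> b \<or> x = n \<otimes> (a \<otimes> b)"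
      using carrier_cases[OF x] unfolding N by blast
    then show ?thesis using gens z(2) by auto
  qed
  then have "carrier G = {\<one>, z, a, z \<otimes> a, b, z \<otimes> b, a \<otimes> b, z \<otimes> (a \<otimes> b)}"
    using gens z(2) by auto
  moreover have "b \<otimes> b = z" "b \<otimes> a = z \<otimes> (a \<otimes> b)"
    using quaternion(2,3) z gens(2) by (simp_all add: numeral_2_eq_2)
  moreover have "b \<noteq> a" "b \<noteq> z \<otimes> a"
  proof -
    \<comment> \<open>\<open>z\<close> and hence \<open>z \<otimes> a\<close> lie in A, but
      \<open>b\<close> does not.\<close>
    have "z \<in> generate G {a}" using inter_eq z(1) generate_self by blast
    then have "z \<otimes> a \<in> generate G {a}"
      using subgroup_mult_mem_iff(1)[OF subgroups(1) _ gens(1)] generate_self by blast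
    then show "b \<noteq> a" "b \<noteq> z \<otimes> a" using indep(3) generate_self[of a] by blast+
  qed
  ultimately show ?thesis using iso_Q8[OF gens(1,2) z_def _ zz _ z1] by blast
qed

end

section \<open>Assembling the classification\<close>

lemma (in group) no_antichain_imp_classification:
  assumes fin: "finite (carrier G)"
    and none: "\<not> (\<exists>S. power_antichain G S \<and> card S = 4)"
  shows "G \<cong> Q8 \<or> G \<cong> integer_mod_group 2 \<times>\<times> integer_mod_group 2
    \<or> (\<exists>p q r. prime p \<and> prime q \<and> prime r \<and> p \<noteq> q \<and> p \<noteq> r \<and> q \<noteq> r
         \<and> G \<cong> integer_mod_group (p * q * r))
    \<or> (\<exists>p q m n. prime p \<and> prime q \<and> p \<noteq> q \<and> {m, n} \<inter> {0, 1, 2} \<noteq> {}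
         \<and> G \<cong> integer_mod_group (p ^ m * q ^ n))"
proof (cases "\<exists>g\<in>carrier G. generate G {g} = carrier G")
  case True
  then obtain g where g: "g \<in> carrier G" "generate G {g} = carrier G" by blast
  have pos: "order G > 0" using fin by (simp add: order_gt_0_iff_finite)
  \<comment> \<open>Four incomparable divisors of the order would give four incomparable elements of
    the cyclic group.\<close>
  have "\<forall>D. (\<forall>d\<in>D. d dvd order G) \<and> (\<forall>d\<in>D. \<forall>e\<in>D. d dvd e \<longrightarrow> d = e) \<longrightarrow> card D \<noteq> 4"
    using cyclic_divisor_antichain[OF fin g] none by metis
  from no_divisor_antichain_of_card_4[OF pos this] cyclic_iso_integer_mod_group[OF fin g]
  show ?thesis by metis
next
  case False
  then obtain a b c where "three_cyclic_cover G a b c"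
    using noncyclic_three_cyclic_cover[OF fin none] by blast
  then show ?thesis using three_cyclic_cover.iso_klein_four_or_Q8 none by metis
qed

theorem theorem2p6:
  fixes G :: "('a, 'b) monoid_scheme"
  assumes "group G" and "finite (carrier G)"
  shows "induced_free (with_proj (complete_bipartite_graph 1 4)) (with_proj (power_graph G)) \<longleftrightarrow>
      G \<cong> Q8
    \<or> G \<cong> integer_mod_group 2 \<times>\<times> integer_mod_group 2
    \<or> (\<exists>(p::nat) (k::nat). prime p \<and> G \<cong> integer_mod_group (p ^ k))
    \<or> (\<exists>(p::nat) (q::nat) (r::nat). prime p \<and> prime q \<and> prime r \<and> p \<noteq> q \<and> p \<noteq> r \<and> q \<noteq> r
         \<and> G \<cong> integer_mod_group (p * q * r))
    \<or> (\<exists>(p::nat) (q::nat) (m::nat) (n::nat). prime p \<and> prime q \<and> p \<noteq> q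
         \<and> {m, n} \<inter> {0, 1, 2} \<noteq> {}
         \<and> G \<cong> integer_mod_group (p ^ m * q ^ n))"
    (is "?free \<longleftrightarrow> ?Q8 \<or> ?V4 \<or> ?Zpk \<or> ?Zpqr \<or> ?Zpmqn")
proof -
  interpret group G by fact
  have free: "?free \<longleftrightarrow> \<not> (\<exists>S. power_antichain G S \<and> card S = 4)"
    by (rule induced_free_power_graph_iff) (use assms(2) in simp_all)
  \<comment> \<open>Prime powers are the two-prime case with exponent 0 at an auxiliary
    prime.\<close>
  have two: "?Zpk \<Longrightarrow> ?Zpmqn"
  proof -
    assume ?Zpk
    then obtain p k :: nat where p: "prime p" "G \<cong> integer_mod_group (p ^ k)" by blast
    obtain q :: nat where "prime q" "p < q" using bigger_prime by blast
    then show ?Zpmqn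
      using p by (intro exI[of _ p] exI[of _ q] exI[of _ k] exI[of _ 0]) auto
  qed
  have Zn: "\<not> (\<exists>S. power_antichain (integer_mod_group n) S \<and> card S = 4)"
    if "n > 0" "\<And>d. d dvd n \<Longrightarrow> c d < 3"
      "\<And>d e. d dvd n \<Longrightarrow> e dvd n \<Longrightarrow> c d = c e \<Longrightarrow> d dvd e \<or> e dvd d"
    for n and c :: "nat \<Rightarrow> nat"
  proof
    assume "\<exists>S. power_antichain (integer_mod_group n) S \<and> card S = 4"
    then obtain S where S: "power_antichain (integer_mod_group n) S" "card S = 4" by blast
    have "card S \<le> 3"
      by (rule card_power_antichain_integer_mod_group_le[OF that(1) S(1) that(2,3)])
    then show False using S(2) by simp
  qed
  have Q8: ?free if ?Q8
    unfolding free
    using card_power_antichain_Q8_le by (intro no_power_antichain_of_iso[OF group_Q8 that]) force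
  have V4: ?free if ?V4
    unfolding free
  proof (rule no_power_antichain_of_iso[OF DirProd_group that])
    let ?K = "integer_mod_group 2 \<times>\<times> integer_mod_group 2"
    show "\<not> (\<exists>T. power_antichain ?K T \<and> card T = 4)"
    proof
      assume "\<exists>T. power_antichain ?K T \<and> card T = 4"
      then obtain T where T: "power_antichain ?K T" and "card T = 4" by blast
      \<comment> \<open>Four elements fill the group and include the identity, which lies in every
        cyclic subgroup and so collapses the antichain to one element.\<close>
      moreover have "card (carrier ?K) = 4" "finite (carrier ?K)"
        by (simp_all add: carrier_integer_mod_group)
      ultimately have "\<one>\<^bsub>?K\<^esub> \<in> T"
        using T card_subset_eq[of "carrier ?K" T]
        by (auto simp: power_antichain_def carrier_integer_mod_group)
      then have "T = {\<one>\<^bsub>?K\<^esub>}"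
        using T generate.one[of ?K] unfolding power_antichain_def by blast
      then show False using \<open>card T = 4\<close> by simp
    qed
  qed simp_all
  have Zpqr: ?free if Z: "?Zpqr"
  proof -
    obtain p q r :: nat where pqr: "prime p" "prime q" "prime r" "p \<noteq> q" "p \<noteq> r" "q \<noteq> r"
      and iso: "G \<cong> integer_mod_group (p * q * r)"
      using Z by blast
    obtain c :: "nat \<Rightarrow> nat" where c: "\<And>d. d dvd p * q * r \<Longrightarrow> c d < 3"
      "\<And>d e. d dvd p * q * r \<Longrightarrow> e dvd p * q * r \<Longrightarrow> c d = c e \<Longrightarrow> d dvd e \<or> e dvd d"
      using divisor_chain_cover_three_primes[OF pqr] by blast
    show ?free unfolding free
      using pqr(1-3) by (intro no_power_antichain_of_iso[OF group_integer_mod_group iso] Zn[OF _ c]) (simp_all add: prime_gt_0_nat)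
  qed
  have Zpmqn: ?free if Z: "?Zpmqn"
  proof -
    obtain p q m n :: nat where pq: "prime p" "prime q" "p \<noteq> q" and "{m, n} \<inter> {0, 1, 2} \<noteq> {}"
      and "G \<cong> integer_mod_group (p ^ m * q ^ n)"
      using Z by blast
    \<comment> \<open>By symmetry in the two primes, the exponent bounded by 2 can be taken to be
      \<open>n\<close>.\<close>
    then obtain p q m n :: nat where pq: "prime p" "prime q" "p \<noteq> q" and n: "n \<le> 2"
      and iso: "G \<cong> integer_mod_group (p ^ m * q ^ n)"
    proof (cases "n \<le> 2")
      case False
      then have "m \<le> 2" using \<open>{m, n} \<inter> {0, 1, 2} \<noteq> {}\<close> by auto
      then show ?thesis
        using that[of q p m n] pq \<open>G \<cong> integer_mod_group (p ^ m * q ^ n)\<close>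
        by (simp add: mult.commute)
    qed (use that pq in blast)
    obtain c :: "nat \<Rightarrow> nat" where c: "\<And>d. d dvd p ^ m * q ^ n \<Longrightarrow> c d < 3"
      "\<And>d e. d dvd p ^ m * q ^ n \<Longrightarrow> e dvd p ^ m * q ^ n \<Longrightarrow> c d = c e \<Longrightarrow> d dvd e \<or> e dvd d"
      using divisor_chain_cover_two_primes[OF pq n] by blast
    show ?free unfolding free
      using pq(1,2) by (intro no_power_antichain_of_iso[OF group_integer_mod_group iso] Zn[OF _ c]) (simp_all add: prime_gt_0_nat)
  qed
  show ?thesis
  proof
    assume ?free
    from no_antichain_imp_classification[OF assms(2) this[unfolded free]]
    show "?Q8 \<or> ?V4 \<or> ?Zpk \<or> ?Zpqr \<or> ?Zpmqn" by blast
  next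
    assume "?Q8 \<or> ?V4 \<or> ?Zpk \<or> ?Zpqr \<or> ?Zpmqn"
    then show ?free using Q8 V4 two Zpqr Zpmqn by argo
  qed
qed

end
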